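(* Let $(X,\mathsf d,\mu)$ be a metric measure space, let $r>0$, and set $w(x):=\int_{B_r(x)}\frac{d\mu(y)}{\mu(B_r(y))}$ for $x\in X$. Then for any $u,v\in L^2(X,w\mu)\cap L^2(X,\mu)$, $$\int_X\big(v\,\Delta_{\mu,r}^{\mathsf d}u-u\,\Delta_{\mu,r}^{\mathsf d}v\big)\,d\mu=\frac1{r^2}\int_Xu(x)\,\frac1{\mu(B_r(x))}\int_{B_r(x)}v(y)\left(\frac{\mu(B_r(x))}{\mu(B_r(y))}-1\right)d\mu(y)\,d\mu(x)$$ $$=\frac1{r^2}\int_Xu(x)\int_{B_r(x)}v(y)\left(\frac1{\mu(B_r(y))}-\frac1{\mu(B_r(x))}\right)d\mu(y)\,d\mu(x).$$
   Context: A metric measure space $(X,\mathsf d,\mu)$ is a metric space with a Borel measure $\mu$ such that $\mu(U)>0$ for every non-empty open $U\subset X$ (balls are understood to have finite measure so that averages over balls make sense). $B_r(x)$ is the ball of center $x$ and radius $r$. $w\mu$ denotes the measure with density $w$ with respect to $\mu$. For $r>0$ and $\mu$-a.e. $x$, $$\Delta_{\mu,r}^{\mathsf d}u(x):=\frac1{r^2}\,\frac1{\mu(B_r(x))}\int_{B_r(x)}\big(u(y)-u(x)\big)\,d\mu(y).$$ *)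

theory Defs
  imports "HOL-Analysis.Analysis"
begin

locale metric_measure_space =
  fixes M :: "'a::metric_space measure"
  assumes sets_eq_borel: "sets M = sets borel"
    and open_pos: "\<And>U. open U \<Longrightarrow> U \<noteq> {} \<Longrightarrow> emeasure M U > 0"
    and ball_finite: "\<And>x \<rho>. emeasure M (ball x \<rho>) < \<infinity>"

text \<open>Real square-integrable functions; elements are representatives, not almost-everywhere classes.\<close>

definition L2 :: "'a measure \<Rightarrow> ('a \<Rightarrow> real) set" where
  "L2 M = {f \<in> borel_measurable M. integrable M (\<lambda>x. (f x)\<^sup>2)}"

text \<open>The weight takes values in the extended non-negative reals: it may be infinite at some points.\<close>

definition ball_weight :: "'a::metric_space measure \<Rightarrow> real \<Rightarrow> 'a \<Rightarrow> ennreal" where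
  "ball_weight M r x = (\<integral>\<^sup>+y\<in>ball x r. (1 / emeasure M (ball y r)) \<partial>M)"

definition ball_laplacian :: "'a::metric_space measure \<Rightarrow> real \<Rightarrow> ('a \<Rightarrow> real) \<Rightarrow> 'a \<Rightarrow> real" where
  "ball_laplacian M r u x =
     1 / r\<^sup>2 * (1 / measure M (ball x r) * (LINT y:ball x r|M. u y - u x))"

end

theory Submission
  imports Defs
begin

text \<open>
  Write \<open>m x\<close> for the measure of \<open>ball x r\<close>. At each point \<open>x\<close> the terms \<open>u x * v x\<close>
  of the two Laplacians cancel, so that \<open>r\<^sup>2\<close> times the left-hand integrand is the
  integral over \<open>ball x r\<close> of \<open>v x * u y / m x - u x * v y / m x\<close>. The pairs \<open>(x, y)\<close> with
  \<open>dist x y < r\<close> form a symmetric set, so exchanging \<open>x\<close> and \<open>y\<close> turns the double integral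
  of \<open>v x * u y / m x\<close> into that of \<open>u x * v y / m y\<close>, and the difference \<open>1 / m y - 1 / m x\<close> of
  the right-hand side appears. The exchange needs Fubini's theorem, which needs three things.

  Integrability: by the inequality of arithmetic and geometric means,
  \<open>\<bar>f x * g y\<bar> / m x\<close> is at most \<open>(f x)\<^sup>2 / m x + (g y)\<^sup>2 / m x\<close>. The first term has the double
  integral of \<open>f\<^sup>2\<close>, since the integral over \<open>y\<close> contributes the factor \<open>m x\<close>; the second one has
  the integral of \<open>g\<^sup>2\<close> against the weight, since the weight at \<open>y\<close> is exactly the integral of
  \<open>1 / m x\<close> over \<open>ball y r\<close>. This is the lemma \<open>square_integrable_kernel\<close>.

  Sigma-finiteness: the space is a countable union of concentric balls, all of finite measure.

  Measurability of the set of pairs with \<open>dist x y < r\<close> for the product sigma-algebra: that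
  sigma-algebra contains every open set of the product when the space is separable. Separability is
  a consequence of the hypotheses on the measure: the points of a separated set are centres of
  disjoint balls of positive measure, of which a ball of finite measure contains only countably
  many.

  The inner integrals exist for almost every \<open>x\<close> because the double integral of \<open>\<bar>f y\<bar> / m y\<close>
  over the pairs with \<open>dist x y < r\<close> and \<open>x\<close> in a fixed ball is finite: the integral over \<open>x\<close>
  contributes at most the factor \<open>m y\<close>.
\<close>

section \<open>Separability and measurability of the near-diagonal set\<close>

context metric_measure_space
begin

lemma space_eq_UNIV [simp]: "space M = UNIV"
  using sets_eq_borel sets_eq_imp_space_eq by fastforce

lemma open_in_sets: "open U \<Longrightarrow> U \<in> sets M"
  by (simp add: sets_eq_borel)

lemma ball_in_sets [measurable, simp]: "ball x \<rho> \<in> sets M"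
  by (simp add: open_in_sets)

lemma emeasure_ball: "emeasure M (ball x \<rho>) = ennreal (measure M (ball x \<rho>))"
  using ball_finite[of x \<rho>] by (simp add: emeasure_eq_ennreal_measure less_top)

lemma measure_ball_pos: "\<rho> > 0 \<Longrightarrow> measure M (ball x \<rho>) > 0"
  using open_pos[of "ball x \<rho>"] by (simp add: emeasure_ball)

text \<open>
  Within a fixed ball, the balls of radius \<open>e/2\<close> around separated points are disjoint and have
  positive measures whose sum is finite, and a summable family has countable support.
\<close>

lemma countable_separated:
  fixes S :: "'a set"
  assumes e: "e > 0" and sep: "\<And>x y. x \<in> S \<Longrightarrow> y \<in> S \<Longrightarrow> x \<noteq> y \<Longrightarrow> e \<le> dist x y"
  shows "countable S"
proof -
  fix x0 :: 'a
  have count: "countable (S \<inter> ball x0 (real n))" for n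
  proof -
    let ?T = "S \<inter> ball x0 (real n)"
    have bound: "(\<Sum>s\<in>F. measure M (ball s (e/2))) \<le> measure M (ball x0 (real n + e))"
      if F: "finite F" "F \<subseteq> ?T" for F
    proof -
      have disj: "disjoint_family_on (\<lambda>s. ball s (e/2)) F"
        unfolding disjoint_family_on_def
      proof (intro ballI impI)
        fix s t assume "s \<in> F" "t \<in> F" "s \<noteq> t"
        then have "e \<le> dist s t" using sep F by blast
        then show "ball s (e/2) \<inter> ball t (e/2) = {}"
          by (auto simp: disjoint_ballI)
      qed
      have "(\<Sum>s\<in>F. measure M (ball s (e/2))) = measure M (\<Union>s\<in>F. ball s (e/2))"
        using F(1) disj ball_finite
        by (intro measure_finite_Union[symmetric]) (auto simp: less_top)
      also have "\<dots> \<le> measure M (ball x0 (real n + e))"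
      proof (rule measure_mono_fmeasurable)
        show "(\<Union>s\<in>F. ball s (e/2)) \<subseteq> ball x0 (real n + e)"
        proof
          fix y assume "y \<in> (\<Union>s\<in>F. ball s (e/2))"
          then obtain s where s: "s \<in> F" "dist s y < e/2" by auto
          then have "dist x0 s < real n" using F by auto
          then show "y \<in> ball x0 (real n + e)"
            using dist_triangle[of x0 y s] s e by auto
        qed
      qed (use F(1) ball_finite in \<open>auto simp: fmeasurable_def intro!: sets.finite_UN\<close>)
      finally show ?thesis .
    qed
    have "(\<lambda>s. measure M (ball s (e/2))) summable_on ?T"
      by (rule nonneg_bdd_above_summable_on) (auto intro!: bdd_aboveI2 bound)
    then have "countable {s \<in> ?T. measure M (ball s (e/2)) \<noteq> 0}"
      by (rule summable_countable_real)
    moreover have "{s \<in> ?T. measure M (ball s (e/2)) \<noteq> 0} = ?T"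
      using measure_ball_pos[of "e/2"] e by (force simp: less_le)
    ultimately show ?thesis by simp
  qed
  have "S = (\<Union>n. S \<inter> ball x0 (real n))"
    using reals_Archimedean2 by (auto simp: mem_ball)
  then show ?thesis using count by (metis countable_UN countableI_type)
qed

text \<open>
  A maximal \<open>e\<close>-separated set, which exists by Zorn's lemma, meets every ball of radius \<open>e\<close>: a
  point at distance at least \<open>e\<close> from it could be added. The union of such sets over
  \<open>e = 1, 1/2, 1/3, \<dots>\<close> is countable and dense.
\<close>

lemma ex_countable_dense:
  "\<exists>D :: 'a set. countable D \<and> (\<forall>x e. e > 0 \<longrightarrow> (\<exists>d\<in>D. dist x d < e))"
proof -
  have "\<exists>S :: 'a set. countable S \<and> (\<forall>x. \<exists>d\<in>S. dist x d < e)" if e: "e > 0" for e :: real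
  proof -
    define \<A> where "\<A> = {S :: 'a set. \<forall>x\<in>S. \<forall>y\<in>S. x \<noteq> y \<longrightarrow> e \<le> dist x y}"
    have "\<exists>S\<in>\<A>. \<forall>T\<in>\<A>. S \<subseteq> T \<longrightarrow> T = S"
    proof (rule subset_Zorn')
      fix C assume C: "subset.chain \<A> C"
      show "\<Union>C \<in> \<A>"
        unfolding \<A>_def
      proof (intro CollectI ballI impI)
        fix x y assume "x \<in> \<Union>C" "y \<in> \<Union>C" "x \<noteq> y"
        then obtain A B where AB: "A \<in> C" "x \<in> A" "B \<in> C" "y \<in> B" by blast
        then have "A \<subseteq> B \<or> B \<subseteq> A" using C by (auto simp: subset.chain_def)
        then obtain S where "S \<in> C" "x \<in> S" "y \<in> S" using AB by blast
        then show "e \<le> dist x y"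
          using C \<open>x \<noteq> y\<close> by (force simp: subset.chain_def \<A>_def)
      qed
    qed
    then obtain S where S: "S \<in> \<A>" and max: "\<And>T. T \<in> \<A> \<Longrightarrow> S \<subseteq> T \<Longrightarrow> T = S" by blast
    have "countable S" using countable_separated[OF e, of S] S by (auto simp: \<A>_def)
    moreover have "\<exists>d\<in>S. dist x d < e" for x
    proof (rule ccontr)
      assume far: "\<not> (\<exists>d\<in>S. dist x d < e)"
      then have "insert x S \<in> \<A>" using S by (auto simp: \<A>_def dist_commute not_less)
      then have "x \<in> S" using max by blast
      then show False using far e by auto
    qed
    ultimately show ?thesis by blast
  qed
  then have "\<forall>k. \<exists>S :: 'a set. countable S \<and> (\<forall>x. \<exists>d\<in>S. dist x d < inverse (Suc k))" by simp
  then obtain S :: "nat \<Rightarrow> 'a set" where S: "\<And>k. countable (S k)"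
    "\<And>k x. \<exists>d\<in>S k. dist x d < inverse (Suc k)" by metis
  show ?thesis
  proof (intro exI conjI allI impI)
    show "countable (\<Union>k. S k)" using S by auto
    fix x :: 'a and e :: real assume "e > 0"
    then obtain k where "inverse (real (Suc k)) < e" using reals_Archimedean by blast
    then show "\<exists>d\<in>\<Union>k. S k. dist x d < e" using S(2)[of k x] by force
  qed
qed

lemma sigma_finite_M: "sigma_finite_measure M"
proof
  fix x0 :: 'a
  show "\<exists>A. countable A \<and> A \<subseteq> sets M \<and> \<Union>A = space M \<and> (\<forall>a\<in>A. emeasure M a \<noteq> \<infinity>)"
    using ball_finite reals_Archimedean2
    by (intro exI[of _ "range (\<lambda>n. ball x0 (real n))"]) (auto simp: less_top[symmetric])
qed

sublocale sigma_finite_measure M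
  by (rule sigma_finite_M)

sublocale square: pair_sigma_finite M M ..

text \<open>
  The set is a countable union of products of balls. The rectangle around a common centre \<open>d\<close>
  with radii \<open>q\<close> and \<open>r - q\<close> lies in it by the triangle inequality.
\<close>

lemma near_diagonal_measurable:
  "{p. dist (fst p) (snd p) < r} \<in> sets (M \<Otimes>\<^sub>M M)"
proof -
  obtain D :: "'a set" where D: "countable D" "\<And>x e. e > 0 \<Longrightarrow> \<exists>d\<in>D. dist x d < e"
    using ex_countable_dense by metis
  have "{p. dist (fst p) (snd p) < r} = (\<Union>d\<in>D. \<Union>q\<in>\<rat>. ball d q \<times> ball d (r - q))" (is "?L = ?R")
  proof (intro set_eqI iffI)
    fix p :: "'a \<times> 'a" assume "p \<in> ?L"
    then obtain x y where p: "p = (x, y)" and xy: "dist x y < r" by (cases p) auto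
    then obtain d where d: "d \<in> D" "dist x d < (r - dist x y) / 2"
      using D(2)[of "(r - dist x y) / 2"] by auto
    then obtain q where q: "q \<in> \<rat>" "dist x d < q" "q < (r - dist x y) / 2"
      using Rats_dense_in_real by blast
    \<comment> \<open>The radius \<open>q\<close> is so small that \<open>2 * q + dist x y < r\<close>.\<close>
    have "dist d y < r - q"
      using dist_triangle[of d y x] q by (simp add: dist_commute)
    then show "p \<in> ?R" using p q d by (auto simp: dist_commute)
  next
    fix p assume "p \<in> ?R"
    then obtain d q where "dist d (fst p) < q" "dist d (snd p) < r - q" by auto
    then show "p \<in> ?L"
      using dist_triangle2[of "fst p" "snd p" d] by (simp add: dist_commute)
  qed
  moreover have "?R \<in> sets (M \<Otimes>\<^sub>M M)"
    using D(1) countable_rat by (intro sets.countable_UN' sets.countable_UN'') auto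
  ultimately show ?thesis by simp
qed

lemma ball_indicator_measurable [measurable]:
  "(\<lambda>p. indicator (ball (fst p) r) (snd p) :: real)
     \<in> borel_measurable (M \<Otimes>\<^sub>M M)"
proof -
  have "(\<lambda>p :: 'a \<times> 'a. indicator (ball (fst p) r) (snd p) :: real) = indicator {p. dist (fst p) (snd p) < r}"
    by (rule ext) (simp add: indicator_def)
  then show ?thesis
    using borel_measurable_indicator[OF near_diagonal_measurable] by (simp only:)
qed

lemma measure_ball_measurable [measurable]: "(\<lambda>x. measure M (ball x r)) \<in> borel_measurable M"
proof -
  have "(\<lambda>x. emeasure M (Pair x -` {p. dist (fst p) (snd p) < r})) \<in> borel_measurable M"
    by (rule measurable_emeasure_Pair[OF near_diagonal_measurable])
  moreover have "Pair x -` {p. dist (fst p) (snd p) < r} = ball x r" for x :: 'a by auto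
  ultimately have "(\<lambda>x. emeasure M (ball x r)) \<in> borel_measurable M" by simp
  then show ?thesis unfolding measure_def by measurable
qed

section \<open>Integrability of the kernels\<close>

lemma indicator_ball_commute: "indicator (ball x r) y = indicator (ball y r) x"
  by (simp add: indicator_def dist_commute)

lemma ball_weight_eq:
  assumes "r > 0"
  shows "ball_weight M r x = (\<integral>\<^sup>+y. ennreal (indicator (ball y r) x / measure M (ball y r)) \<partial>M)"
  unfolding ball_weight_def
proof (intro nn_integral_cong)
  fix y
  have "1 / emeasure M (ball y r) = ennreal (1 / measure M (ball y r))"
    using divide_ennreal[OF zero_le_one measure_ball_pos[OF assms, of y]]
    by (simp add: emeasure_ball)
  then show "1 / emeasure M (ball y r) * indicator (ball x r) y
     = ennreal (indicator (ball y r) x / measure M (ball y r))"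
    by (simp add: indicator_ball_commute[of x] split: split_indicator)
qed

lemma ball_weight_measurable:
  assumes "r > 0"
  shows "ball_weight M r \<in> borel_measurable M"
proof -
  have "(\<lambda>x. \<integral>\<^sup>+y. ennreal (indicator (ball x r) y / measure M (ball y r)) \<partial>M) \<in> borel_measurable M"
    by (rule borel_measurable_nn_integral_fst[of "\<lambda>p. ennreal (indicator (ball (fst p) r) (snd p) / measure M (ball (snd p) r))", simplified])
       measurable
  moreover have "ball_weight M r = (\<lambda>x. \<integral>\<^sup>+y. ennreal (indicator (ball x r) y / measure M (ball y r)) \<partial>M)"
    using assms by (auto simp: ball_weight_eq indicator_ball_commute)
  ultimately show ?thesis by simp
qed

text \<open>
  This is where the weight comes from: \<open>f\<close> and \<open>g\<close> play different roles, because the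
  kernel is normalised by the ball around the argument of \<open>f\<close>. The factor \<open>m x\<close> cancels when
  \<open>(f x)\<^sup>2 / m x\<close> is integrated over \<open>y\<close>, whereas integrating \<open>(g y)\<^sup>2 / m x\<close> over \<open>x\<close> produces
  the weight at \<open>y\<close>.
\<close>

lemma square_integrable_kernel:
  assumes r: "r > 0" and f: "f \<in> L2 M" and g: "g \<in> L2 (density M (ball_weight M r))"
  shows "integrable (M \<Otimes>\<^sub>M M)
    (\<lambda>p. indicator (ball (fst p) r) (snd p) * (f (fst p) * g (snd p) / measure M (ball (fst p) r)))"
    (is "integrable _ ?k")
proof -
  have [measurable]: "f \<in> borel_measurable M" "g \<in> borel_measurable M"
    using f g by (auto simp: L2_def)
  let ?m = "\<lambda>x. measure M (ball x r)"
  let ?i = "\<lambda>p. indicator (ball (fst p) r) (snd p) :: real"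
  have m: "?m x > 0" for x using r by (rule measure_ball_pos)
  have A: "integrable (M \<Otimes>\<^sub>M M) (\<lambda>p. ?i p * ((f (fst p))\<^sup>2 / ?m (fst p)))" (is "integrable _ ?A")
  proof (rule integrableI_nonneg)
    have "(\<integral>\<^sup>+p. ennreal (?A p) \<partial>(M \<Otimes>\<^sub>M M)) = (\<integral>\<^sup>+x. \<integral>\<^sup>+y. ennreal (?A (x, y)) \<partial>M \<partial>M)"
      by (rule nn_integral_fst[symmetric]) measurable
    also have "\<dots> = (\<integral>\<^sup>+x. ennreal ((f x)\<^sup>2) \<partial>M)"
    proof (intro nn_integral_cong)
      fix x
      have "(\<integral>\<^sup>+y. ennreal (?A (x, y)) \<partial>M)
          = (\<integral>\<^sup>+y. ennreal ((f x)\<^sup>2 / ?m x) * indicator (ball x r) y \<partial>M)"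
        by (intro nn_integral_cong) (auto simp: indicator_def)
      also have "\<dots> = ennreal ((f x)\<^sup>2 / ?m x) * emeasure M (ball x r)"
        by (rule nn_integral_cmult_indicator) simp
      also have "\<dots> = ennreal ((f x)\<^sup>2)"
        using m[of x] by (simp add: emeasure_ball flip: ennreal_mult)
      finally show "(\<integral>\<^sup>+y. ennreal (?A (x, y)) \<partial>M) = ennreal ((f x)\<^sup>2)" .
    qed
    also have "\<dots> < \<infinity>" using f by (auto simp: L2_def integrable_iff_bounded)
    finally show "(\<integral>\<^sup>+p. ennreal (?A p) \<partial>(M \<Otimes>\<^sub>M M)) < \<infinity>" .
  qed (use m in \<open>auto simp: less_imp_le\<close>)
  have B: "integrable (M \<Otimes>\<^sub>M M) (\<lambda>p. ?i p * ((g (snd p))\<^sup>2 / ?m (fst p)))" (is "integrable _ ?B")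
  proof (rule integrableI_nonneg)
    have "(\<integral>\<^sup>+p. ennreal (?B p) \<partial>(M \<Otimes>\<^sub>M M)) = (\<integral>\<^sup>+y. \<integral>\<^sup>+x. ennreal (?B (x, y)) \<partial>M \<partial>M)"
      by (rule square.nn_integral_snd[symmetric]) measurable
    also have "\<dots> = (\<integral>\<^sup>+y. ball_weight M r y * ennreal ((g y)\<^sup>2) \<partial>M)"
    proof (intro nn_integral_cong)
      fix y
      have "(\<integral>\<^sup>+x. ennreal (?B (x, y)) \<partial>M)
          = (\<integral>\<^sup>+x. ennreal (indicator (ball x r) y / ?m x) * ennreal ((g y)\<^sup>2) \<partial>M)"
        by (intro nn_integral_cong) (simp add: mult.commute flip: ennreal_mult)
      also have "\<dots> = ball_weight M r y * ennreal ((g y)\<^sup>2)"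
        unfolding ball_weight_eq[OF r]
        by (rule nn_integral_multc)
           (unfold indicator_ball_commute[where y = y], measurable)
      finally show "(\<integral>\<^sup>+x. ennreal (?B (x, y)) \<partial>M) = ball_weight M r y * ennreal ((g y)\<^sup>2)" .
    qed
    also have "\<dots> = (\<integral>\<^sup>+y. ennreal ((g y)\<^sup>2) \<partial>density M (ball_weight M r))"
      by (rule nn_integral_density[symmetric]) (use ball_weight_measurable[OF r] in auto)
    also have "\<dots> < \<infinity>" using g by (auto simp: L2_def integrable_iff_bounded)
    finally show "(\<integral>\<^sup>+p. ennreal (?B p) \<partial>(M \<Otimes>\<^sub>M M)) < \<infinity>" .
  qed (use m in \<open>auto simp: less_imp_le\<close>)
  show ?thesis
  proof (rule Bochner_Integration.integrable_bound[OF Bochner_Integration.integrable_add[OF A B]])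
    show "?k \<in> borel_measurable (M \<Otimes>\<^sub>M M)" by measurable
    have "norm (?k p) \<le> norm (?A p + ?B p)" for p
    proof -
      have "2 * (\<bar>f (fst p)\<bar> * \<bar>g (snd p)\<bar>) \<le> (f (fst p))\<^sup>2 + (g (snd p))\<^sup>2"
        using sum_squares_bound[of "\<bar>f (fst p)\<bar>" "\<bar>g (snd p)\<bar>"] by simp
      then have "\<bar>f (fst p)\<bar> * \<bar>g (snd p)\<bar> \<le> (f (fst p))\<^sup>2 + (g (snd p))\<^sup>2"
        by (smt (verit) mult_nonneg_nonneg abs_ge_zero)
      then have "\<bar>f (fst p)\<bar> * \<bar>g (snd p)\<bar> / ?m (fst p) \<le> ((f (fst p))\<^sup>2 + (g (snd p))\<^sup>2) / ?m (fst p)"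
        using m[of "fst p"] by (simp add: divide_right_mono)
      then show ?thesis
        using m[of "fst p"] by (auto simp: indicator_def abs_mult add_divide_distrib)
    qed
    then show "AE p in M \<Otimes>\<^sub>M M. norm (?k p) \<le> norm (?A p + ?B p)" by simp
  qed
qed

text \<open>
  A ball has finite measure, so \<open>\<bar>f\<bar> \<le> 1 + f\<^sup>2\<close> gives an integrable bound on it.
\<close>

lemma L2_set_integrable_ball:
  assumes "f \<in> L2 M"
  shows "set_integrable M (ball x \<rho>) f"
  unfolding set_integrable_def
proof (rule Bochner_Integration.integrable_bound)
  have [measurable]: "f \<in> borel_measurable M" using assms by (auto simp: L2_def)
  show "integrable M (\<lambda>y. indicator (ball x \<rho>) y + (f y)\<^sup>2)"
    using assms ball_finite by (auto simp: L2_def intro!: integrable_real_indicator)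
  show "(\<lambda>y. indicator (ball x \<rho>) y *\<^sub>R f y) \<in> borel_measurable M" by measurable
  have "\<bar>t\<bar> \<le> 1 + t\<^sup>2" for t :: real
    using sum_squares_bound[of "\<bar>t\<bar>" 1] by simp
  then show "AE y in M. norm (indicator (ball x \<rho>) y *\<^sub>R f y) \<le> norm (indicator (ball x \<rho>) y + (f y)\<^sup>2)"
    by (auto simp: indicator_def)
qed

text \<open>
  With \<open>x\<close> restricted to a ball of radius \<open>n\<close>, only the points \<open>y\<close> of the ball of radius \<open>n + r\<close>
  matter, and integrating \<open>\<bar>f y\<bar> / m y\<close> over \<open>x \<in> ball y r\<close> first gives at most \<open>\<bar>f y\<bar>\<close>. So
  the double integral is finite, and Fubini's theorem gives the claim for almost every such \<open>x\<close>.
\<close>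

lemma AE_set_integrable_div_measure_ball:
  assumes r: "r > 0" and f: "\<And>x \<rho>. set_integrable M (ball x \<rho>) f"
    and [measurable]: "f \<in> borel_measurable M"
  shows "AE x in M. set_integrable M (ball x r) (\<lambda>y. f y / measure M (ball y r))"
proof -
  let ?m = "\<lambda>x. measure M (ball x r)"
  have m: "?m x > 0" for x using r by (rule measure_ball_pos)
  fix x0 :: 'a
  have "AE x in M. x \<in> ball x0 (real n) \<longrightarrow> set_integrable M (ball x r) (\<lambda>y. f y / ?m y)" for n
  proof -
    let ?k = "\<lambda>p. indicator (ball x0 (real n)) (fst p) * indicator (ball (fst p) r) (snd p)
        * (f (snd p) / ?m (snd p)) :: real"
    have "integrable (M \<Otimes>\<^sub>M M) ?k"
    proof (rule integrableI_bounded)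
      have "(\<integral>\<^sup>+p. ennreal (norm (?k p)) \<partial>(M \<Otimes>\<^sub>M M)) = (\<integral>\<^sup>+y. \<integral>\<^sup>+x. ennreal (norm (?k (x, y))) \<partial>M \<partial>M)"
        by (rule square.nn_integral_snd[symmetric]) measurable
      also have "\<dots> \<le> (\<integral>\<^sup>+y. ennreal (norm (indicator (ball x0 (real n + r)) y *\<^sub>R f y)) \<partial>M)"
      proof (intro nn_integral_mono)
        fix y
        have "(\<integral>\<^sup>+x. ennreal (norm (?k (x, y))) \<partial>M)
          \<le> (\<integral>\<^sup>+x. ennreal (indicator (ball x0 (real n + r)) y * \<bar>f y\<bar> / ?m y) * indicator (ball y r) x \<partial>M)"
        proof (intro nn_integral_mono)
          fix x
          have "dist x0 y < real n + r" if "dist x0 x < real n" "dist x y < r"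
            using dist_triangle[of x0 y x] that by simp
          then show "ennreal (norm (?k (x, y)))
            \<le> ennreal (indicator (ball x0 (real n + r)) y * \<bar>f y\<bar> / ?m y) * indicator (ball y r) x"
            by (auto simp: indicator_def dist_commute abs_mult)
        qed
        also have "\<dots> = ennreal (indicator (ball x0 (real n + r)) y * \<bar>f y\<bar> / ?m y) * emeasure M (ball y r)"
          by (rule nn_integral_cmult_indicator) simp
        also have "\<dots> = ennreal (norm (indicator (ball x0 (real n + r)) y *\<^sub>R f y))"
          using m[of y] by (simp add: emeasure_ball abs_mult flip: ennreal_mult)
        finally show "(\<integral>\<^sup>+x. ennreal (norm (?k (x, y))) \<partial>M)
          \<le> ennreal (norm (indicator (ball x0 (real n + r)) y *\<^sub>R f y))" .
      qed
      also have "\<dots> < \<infinity>"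
        using f[of x0 "real n + r"] by (simp only: set_integrable_def integrable_iff_bounded)
      finally show "(\<integral>\<^sup>+p. ennreal (norm (?k p)) \<partial>(M \<Otimes>\<^sub>M M)) < \<infinity>" .
    qed measurable
    then have "AE x in M. integrable M (\<lambda>y. ?k (x, y))"
      by (rule square.AE_integrable_fst')
    then show ?thesis
      by eventually_elim (auto simp: set_integrable_def)
  qed
  then have "AE x in M. \<forall>n. x \<in> ball x0 (real n) \<longrightarrow> set_integrable M (ball x r) (\<lambda>y. f y / ?m y)"
    unfolding AE_all_countable by blast
  then show ?thesis
    by eventually_elim (use reals_Archimedean2 in auto)
qed

lemma L2_set_integrable_quotients:
  assumes r: "r > 0" and f: "f \<in> L2 M"
  shows "AE x in M. set_integrable M (ball x r) (\<lambda>y. f y - f x) \<and>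
    set_integrable M (ball x r) (\<lambda>y. f y * (measure M (ball x r) / measure M (ball y r) - 1)) \<and>
    set_integrable M (ball x r) (\<lambda>y. f y * (1 / measure M (ball y r) - 1 / measure M (ball x r)))"
proof -
  let ?m = "\<lambda>x. measure M (ball x r)"
  have loc: "set_integrable M (ball x \<rho>) f" for x \<rho>
    using f by (rule L2_set_integrable_ball)
  have const: "set_integrable M (ball x r) (\<lambda>y. c)" for x and c :: real
    using ball_finite by (simp add: set_integrable_def)
  have "f \<in> borel_measurable M" using f by (simp add: L2_def)
  then have "AE x in M. set_integrable M (ball x r) (\<lambda>y. f y / ?m y)"
    by (rule AE_set_integrable_div_measure_ball[OF r loc])
  then show ?thesis
  proof eventually_elim
    fix x assume div: "set_integrable M (ball x r) (\<lambda>y. f y / ?m y)"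
    have diff: "set_integrable M (ball x r) (\<lambda>y. f y * (1 / ?m y - 1 / ?m x))"
      using set_integral_diff(1)[OF div set_integrable_mult_right[where a = "1 / ?m x", OF loc]]
      by (simp add: algebra_simps)
    have "?m x \<noteq> 0" using measure_ball_pos[OF r, of x] by simp
    then have "(\<lambda>y. f y * (?m x / ?m y - 1)) = (\<lambda>y. ?m x * (f y * (1 / ?m y - 1 / ?m x)))"
      by (simp add: fun_eq_iff algebra_simps)
    then have "set_integrable M (ball x r) (\<lambda>y. f y * (?m x / ?m y - 1))"
      using set_integrable_mult_right[where a = "?m x", OF diff] by (simp only:)
    then show "set_integrable M (ball x r) (\<lambda>y. f y - f x) \<and>
      set_integrable M (ball x r) (\<lambda>y. f y * (?m x / ?m y - 1)) \<and>
      set_integrable M (ball x r) (\<lambda>y. f y * (1 / ?m y - 1 / ?m x))"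
      using diff set_integral_diff(1)[OF loc const] by blast
  qed
qed

section \<open>Green's identity for the averaged Laplacian\<close>

lemma ball_laplacian_eq:
  assumes "r > 0" "set_integrable M (ball x r) f"
  shows "ball_laplacian M r f x = 1 / r\<^sup>2 * ((LINT y:ball x r|M. f y) / measure M (ball x r) - f x)"
proof -
  have "(LINT y:ball x r|M. f y - f x) = (LINT y:ball x r|M. f y) - (LINT y:ball x r|M. f x)"
    by (rule set_integral_diff) (use assms ball_finite in \<open>auto simp: set_integrable_def\<close>)
  also have "(LINT y:ball x r|M. f x) = measure M (ball x r) * f x"
    using ball_finite by (simp add: set_lebesgue_integral_def)
  finally show ?thesis
    using measure_ball_pos[OF assms(1), of x] by (simp add: ball_laplacian_def field_simps)
qed

end

theorem theorem5p3:
  fixes M :: "'a::metric_space measure" and r :: real and u v :: "'a \<Rightarrow> real"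
  assumes "metric_measure_space M"
    and "r > 0"
    and "u \<in> L2 (density M (ball_weight M r)) \<inter> L2 M"
    and "v \<in> L2 (density M (ball_weight M r)) \<inter> L2 M"
  shows
    "(AE x in M.
        set_integrable M (ball x r) (\<lambda>y. u y - u x) \<and>
        set_integrable M (ball x r) (\<lambda>y. v y - v x) \<and>
        set_integrable M (ball x r)
          (\<lambda>y. v y * (measure M (ball x r) / measure M (ball y r) - 1)) \<and>
        set_integrable M (ball x r)
          (\<lambda>y. v y * (1 / measure M (ball y r) - 1 / measure M (ball x r)))) \<and>
     integrable M (\<lambda>x. v x * ball_laplacian M r u x - u x * ball_laplacian M r v x) \<and>
     integrable M (\<lambda>x. u x * (1 / measure M (ball x r) *
        (LINT y:ball x r|M. v y * (measure M (ball x r) / measure M (ball y r) - 1)))) \<and>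
     integrable M (\<lambda>x. u x *
        (LINT y:ball x r|M. v y * (1 / measure M (ball y r) - 1 / measure M (ball x r)))) \<and>
     (LINT x|M. v x * ball_laplacian M r u x - u x * ball_laplacian M r v x)
       = 1 / r\<^sup>2 * (LINT x|M. u x * (1 / measure M (ball x r) *
           (LINT y:ball x r|M. v y * (measure M (ball x r) / measure M (ball y r) - 1)))) \<and>
     1 / r\<^sup>2 * (LINT x|M. u x * (1 / measure M (ball x r) *
           (LINT y:ball x r|M. v y * (measure M (ball x r) / measure M (ball y r) - 1))))
       = 1 / r\<^sup>2 * (LINT x|M. u x *
           (LINT y:ball x r|M. v y * (1 / measure M (ball y r) - 1 / measure M (ball x r))))"
proof -
  interpret metric_measure_space M by fact
  note r = \<open>r > 0\<close>
  have u: "u \<in> L2 M" "u \<in> L2 (density M (ball_weight M r))"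
    and v: "v \<in> L2 M" "v \<in> L2 (density M (ball_weight M r))"
    using assms by auto
  then have [measurable]: "u \<in> borel_measurable M" "v \<in> borel_measurable M"
    by (auto simp: L2_def)
  let ?m = "\<lambda>x. measure M (ball x r)"
  let ?L = "\<lambda>x. v x * ball_laplacian M r u x - u x * ball_laplacian M r v x"
  let ?C = "\<lambda>x. u x * (1 / ?m x * (LINT y:ball x r|M. v y * (?m x / ?m y - 1)))"
  let ?R = "\<lambda>x. u x * (LINT y:ball x r|M. v y * (1 / ?m y - 1 / ?m x))"
  have m: "?m x \<noteq> 0" for x using measure_ball_pos[OF r, of x] by simp

  \<comment> \<open>\<open>F\<close> and \<open>G\<close> are the two kernels of the left-hand side. \<open>H\<close> is the reflection of \<open>G\<close>; by
    the symmetry of the distance only its denominator differs from that of \<open>F\<close>.\<close>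
  define F where "F = (\<lambda>p. indicator (ball (fst p) r) (snd p) * (u (fst p) * v (snd p) / ?m (fst p)))"
  define G where "G = (\<lambda>p. indicator (ball (fst p) r) (snd p) * (v (fst p) * u (snd p) / ?m (fst p)))"
  define H where "H = (\<lambda>(x, y). G (y, x))"
  have F: "integrable (M \<Otimes>\<^sub>M M) F"
    unfolding F_def by (rule square_integrable_kernel[OF r u(1) v(2)])
  have G: "integrable (M \<Otimes>\<^sub>M M) G"
    unfolding G_def by (rule square_integrable_kernel[OF r v(1) u(2)])
  have H: "integrable (M \<Otimes>\<^sub>M M) H"
    unfolding H_def using G by (rule square.integrable_product_swap)
  have H_eq: "H (x, y) = indicator (ball x r) y * (u x * v y / ?m y)" for x y
    by (simp add: H_def G_def indicator_ball_commute[where x = x and y = y] mult.commute)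
  have swap: "integral\<^sup>L (M \<Otimes>\<^sub>M M) H = integral\<^sup>L (M \<Otimes>\<^sub>M M) G"
    unfolding H_def by (rule square.integral_product_swap) (use G in simp)
  have GF: "integrable (M \<Otimes>\<^sub>M M) (\<lambda>p. G p - F p)" and HF: "integrable (M \<Otimes>\<^sub>M M) (\<lambda>p. H p - F p)"
    using F G H by auto

  have L_eq: "?L x = 1 / r\<^sup>2 * (LINT y|M. G (x, y) - F (x, y))" for x
  proof -
    have loc: "set_integrable M (ball x r) u" "set_integrable M (ball x r) v"
      using u v by (auto intro: L2_set_integrable_ball)
    have "(LINT y|M. G (x, y) - F (x, y))
        = (LINT y:ball x r|M. v x / ?m x * u y - u x / ?m x * v y)"
      unfolding set_lebesgue_integral_def
      by (intro Bochner_Integration.integral_cong) (auto simp: G_def F_def algebra_simps)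
    also have "\<dots> = v x / ?m x * (LINT y:ball x r|M. u y) - u x / ?m x * (LINT y:ball x r|M. v y)"
      using loc by (subst set_integral_diff(2)) auto
    finally have inner: "(LINT y|M. G (x, y) - F (x, y))
        = v x / ?m x * (LINT y:ball x r|M. u y) - u x / ?m x * (LINT y:ball x r|M. v y)" .
    show ?thesis
      unfolding inner using loc by (simp add: ball_laplacian_eq[OF r] right_diff_distrib)
  qed
  \<comment> \<open>This holds at every point, not only almost everywhere: where the integral over the
    ball does not exist, both sides have the default value \<open>0\<close>.\<close>
  have R_eq: "?R x = (LINT y|M. H (x, y) - F (x, y))" for x
  proof -
    have "?R x = (LINT y:ball x r|M. u x * (v y * (1 / ?m y - 1 / ?m x)))"
      by simp
    also have "\<dots> = (LINT y|M. H (x, y) - F (x, y))"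
      unfolding set_lebesgue_integral_def
      by (intro Bochner_Integration.integral_cong) (auto simp: H_eq F_def algebra_simps)
    finally show ?thesis .
  qed
  have C_eq: "?C x = ?R x" for x
  proof -
    have "1 / ?m x * (v y * (?m x / ?m y - 1)) = v y * (1 / ?m y - 1 / ?m x)" for y
      using m[of x] by (simp add: algebra_simps)
    then show ?thesis by (simp only: set_integral_mult_right[symmetric])
  qed

  have int_L: "integrable M ?L"
    unfolding L_eq using square.integrable_fst'[OF GF] by simp
  have int_R: "integrable M ?R"
    unfolding R_eq using square.integrable_fst'[OF HF] by simp
  have "integral\<^sup>L M ?L = 1 / r\<^sup>2 * integral\<^sup>L (M \<Otimes>\<^sub>M M) (\<lambda>p. G p - F p)"
    unfolding L_eq using square.integral_fst'[OF GF] by simp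
  also have "integral\<^sup>L (M \<Otimes>\<^sub>M M) (\<lambda>p. G p - F p) = integral\<^sup>L (M \<Otimes>\<^sub>M M) (\<lambda>p. H p - F p)"
    using F G H swap by simp
  also have "\<dots> = integral\<^sup>L M ?R"
    unfolding R_eq using square.integral_fst'[OF HF] by simp
  finally have identity: "integral\<^sup>L M ?L = 1 / r\<^sup>2 * integral\<^sup>L M ?R" .

  have "AE x in M. set_integrable M (ball x r) (\<lambda>y. u y - u x) \<and>
        set_integrable M (ball x r) (\<lambda>y. v y - v x) \<and>
        set_integrable M (ball x r) (\<lambda>y. v y * (?m x / ?m y - 1)) \<and>
        set_integrable M (ball x r) (\<lambda>y. v y * (1 / ?m y - 1 / ?m x))"
    using L2_set_integrable_quotients[OF r u(1)] L2_set_integrable_quotients[OF r v(1)]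
    by eventually_elim blast
  then show ?thesis
    using int_L int_R identity unfolding C_eq by blast
qed

end
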